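(* Let $K_{n+1}=(V,E,r)$ be the complete directed graph on $n+1$ vertices $V=\hat V\cup\{s\}$, $|\hat V|=n$, $s\notin\hat V$, $E=\{(x,y)\in V\times V:x\neq y\}$, with non-negative edge weights $r(e)\ge0$. Let $\hat K_n=(\hat V,\hat E,\hat r)$ be its generalized star-delta reduction obtained by removing $s$. Let $x_1\in\hat V$, and let $\mathcal T_{x_1}$ and $\hat{\mathcal T}_{x_1}$ be the sets of arborescences rooted at $x_1$ of $K_{n+1}$ and $\hat K_n$ respectively. Then $$r(\mathcal T_{x_1})=r^{\mathrm{out}}(s)\;\hat r(\hat{\mathcal T}_{x_1}),\qquad r^{\mathrm{out}}(s):=\sum_{x\in\hat V}r(s,x).$$
   Context: An arborescence of a digraph rooted at $x$ is a spanning directed subgraph containing, for every vertex $y$, a unique directed path from $y$ to $x$ (edges point towards the root; the path from $x$ to itself is trivial). The weight of a subgraph $\gamma$ is $r(\gamma)=\prod_{e\in\gamma}r(e)$ and that of a collection $\mathcal G$ of subgraphs is $r(\mathcal G)=\sum_{\gamma\in\mathcal G}r(\gamma)$; similarly with $\hat r$. The generalized star-delta reduction $\hat K_n$ is the complete directed graph on $\hat V$, $\hat E=\{(x,x')\in\hat V\times\hat V:x\ne x'\}$, with weights $\hat r(x,x')=r(x,x')+r^*(x,x')$, where $r^*(x,x')=\dfrac{r(x,s)\,r(s,x')}{r^{\mathrm{out}}(s)}$ if $r^{\mathrm{out}}(s)\neq0$ and $r^*(x,x')=0$ if $r^{\mathrm{out}}(s)=0$. *)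

theory Defs
  imports Complex_Main "Graph_Theory.Digraph_Component"
begin

definition complete_graph_on :: "'a set \<Rightarrow> ('a, 'a \<times> 'a) pre_digraph" where
  "complete_graph_on V =
     \<lparr>verts = V, arcs = {(x, y) \<in> V \<times> V. x \<noteq> y}, tail = fst, head = snd\<rparr>"

text \<open>
  A directed path from $y$ to the root is an arc walk (consecutive arcs, repetitions not
  excluded beforehand). Uniqueness of the walk then rules out all cycles. In particular the
  instance at the root itself says that its only closed walk is the trivial one. If only
  simple paths were counted, superfluous arcs (such as arcs leaving the root) would be allowed.
\<close>
definition arborescences :: "('a, 'b) pre_digraph \<Rightarrow> 'a \<Rightarrow> ('a, 'b) pre_digraph set" where
  "arborescences G x =
     {T. spanning T G \<and> (\<forall>y \<in> verts G. \<exists>!p. pre_digraph.awalk T y p x)}"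

definition subgraph_weight :: "('b \<Rightarrow> real) \<Rightarrow> ('a, 'b) pre_digraph \<Rightarrow> real" where
  "subgraph_weight r T = (\<Prod>e \<in> arcs T. r e)"

definition collection_weight :: "('b \<Rightarrow> real) \<Rightarrow> ('a, 'b) pre_digraph set \<Rightarrow> real" where
  "collection_weight r \<G> = (\<Sum>T \<in> \<G>. subgraph_weight r T)"

text \<open>
  In the following definitions \<open>W\<close> is the vertex set that remains after removing \<open>s\<close>.
\<close>
definition out_weight :: "'a set \<Rightarrow> ('a \<times> 'a \<Rightarrow> real) \<Rightarrow> 'a \<Rightarrow> real" where
  "out_weight W r s = (\<Sum>x \<in> W. r (s, x))"

definition star_weight :: "'a set \<Rightarrow> ('a \<times> 'a \<Rightarrow> real) \<Rightarrow> 'a \<Rightarrow> 'a \<times> 'a \<Rightarrow> real" where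
  "star_weight W r s = (\<lambda>(x, x').
     if out_weight W r s \<noteq> 0 then r (x, s) * r (s, x') / out_weight W r s else 0)"

definition star_delta_weight :: "'a set \<Rightarrow> ('a \<times> 'a \<Rightarrow> real) \<Rightarrow> 'a \<Rightarrow> 'a \<times> 'a \<Rightarrow> real" where
  "star_delta_weight W r s = (\<lambda>e. r e + star_weight W r s e)"

end

theory Submission
  imports Defs
begin

text \<open>
  An arborescence rooted at \<open>x\<close> is a map \<open>f\<close> assigning to every vertex \<open>y \<noteq> x\<close> the endpoint of its
  unique outgoing arc, such that iterating \<open>f\<close> leads every vertex to \<open>x\<close>. Let \<open>\<Phi> f\<close> be the
  \<open>r(s, _)\<close>-weighted count of the values \<open>z\<close> of \<open>s\<close> for which this holds. The key identity says
  that choosing the value of a vertex \<open>b\<close> at random in \<open>W\<close>, with weights \<open>r(s, z) / r\<^sup>o\<^sup>u\<^sup>t(s)\<close>, has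
  the same effect on \<open>\<Phi>\<close> as sending \<open>b\<close> to \<open>s\<close>. Applying it to one vertex after the other turns the
  weights \<open>r + r\<^sup>*\<close> on maps into \<open>W\<close> into the weights \<open>r\<close> on maps into \<open>W \<union> {s}\<close>; and \<open>\<Phi>\<close> equals
  \<open>r\<^sup>o\<^sup>u\<^sup>t(s)\<close> on arborescences of the reduced graph, since any value of \<open>s\<close> is then allowed.
\<close>

text \<open>
  The iteration stops on entering \<open>Z\<close>, so the values of \<open>f\<close> on \<open>Z\<close> (in particular the junk value
  of an extensional function at the root) play no role.
\<close>
inductive hits :: "('a \<Rightarrow> 'a) \<Rightarrow> 'a set \<Rightarrow> 'a \<Rightarrow> 'a \<Rightarrow> bool"
  for f :: "'a \<Rightarrow> 'a" and Z :: "'a set" and t :: 'a where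
  stop: "t \<in> Z \<Longrightarrow> hits f Z t t"
| step: "y \<notin> Z \<Longrightarrow> hits f Z t (f y) \<Longrightarrow> hits f Z t y"

definition flows_to :: "'a set \<Rightarrow> 'a \<Rightarrow> ('a \<Rightarrow> 'a) \<Rightarrow> bool" where
  "flows_to V x f \<longleftrightarrow> (\<forall>y\<in>V. hits f {x} x y)"

definition functional_graph :: "'a set \<Rightarrow> 'a \<Rightarrow> ('a \<Rightarrow> 'a) \<Rightarrow> ('a, 'a \<times> 'a) pre_digraph" where
  "functional_graph V x f =
     \<lparr>verts = V, arcs = (\<lambda>y. (y, f y)) ` (V - {x}), tail = fst, head = snd\<rparr>"

section \<open>Iterating a map until it enters a stopping set\<close>

lemma hits_stop_iff: "y \<in> Z \<Longrightarrow> hits f Z t y \<longleftrightarrow> y = t"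
  by (auto intro: hits.stop elim: hits.cases)

lemma hits_step_iff: "y \<notin> Z \<Longrightarrow> hits f Z t y \<longleftrightarrow> hits f Z t (f y)"
  by (auto intro: hits.step elim: hits.cases)

lemma hits_unique: "hits f Z t y \<Longrightarrow> hits f Z t' y \<Longrightarrow> t = t'"
  by (induction rule: hits.induct) (auto simp: hits_stop_iff hits_step_iff)

text \<open>The iteration never leaves a set closed under \<open>f\<close>, so no point of such a
  set reaches a target outside it. Cycles away from the root are excluded this way.\<close>

lemma hits_avoids:
  assumes "hits f Z t y" and "t \<notin> N" and "\<And>u. u \<in> N \<Longrightarrow> f u \<in> N"
  shows "y \<notin> N"
  using assms by (induction rule: hits.induct) auto

lemma hits_cong_closed:
  assumes "hits f Z t y" and "y \<in> W" and "\<And>u. u \<in> W - Z \<Longrightarrow> f u = g u \<and> f u \<in> W"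
  shows "hits g Z t y"
  using assms by (induction rule: hits.induct) (auto intro: hits.intros, metis hits.step)

section \<open>Arborescences as maps\<close>

lemma awalk_functional_graph_Cons:
  "pre_digraph.awalk (functional_graph V x f) u (e # p) v \<longleftrightarrow>
     u \<in> V - {x} \<and> e = (u, f u) \<and> set p \<subseteq> arcs (functional_graph V x f) \<and>
     pre_digraph.cas (functional_graph V x f) (f u) p v"
  by (auto simp: pre_digraph.awalk_def pre_digraph.cas.simps functional_graph_def)

text \<open>Each vertex other than \<open>x\<close> has one outgoing arc and \<open>x\<close> has
  none, so every step of a walk to \<open>x\<close>, and its end, is forced.\<close>

lemma awalk_functional_graph_unique:
  assumes "f \<in> V - {x} \<rightarrow> V"
  shows "pre_digraph.awalk (functional_graph V x f) y p x \<Longrightarrow>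
         pre_digraph.awalk (functional_graph V x f) y q x \<Longrightarrow> p = q"
proof (induction p arbitrary: y q)
  case Nil
  then have "y = x" by (simp add: pre_digraph.awalk_def pre_digraph.cas.simps)
  with Nil.prems(2) show ?case
    by (cases q) (auto simp: awalk_functional_graph_Cons)
next
  case (Cons e p)
  then have y: "y \<in> V - {x}" and e: "e = (y, f y)"
    by (auto simp: awalk_functional_graph_Cons)
  obtain e' q' where q: "q = e' # q'"
    using Cons.prems(2) y by (cases q) (auto simp: pre_digraph.awalk_def pre_digraph.cas.simps)
  have "f y \<in> V" using assms y by auto
  then have "pre_digraph.awalk (functional_graph V x f) (f y) p x"
    "pre_digraph.awalk (functional_graph V x f) (f y) q' x"
    using Cons.prems unfolding q awalk_functional_graph_Cons
    by (auto simp: pre_digraph.awalk_def functional_graph_def)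
  then have "p = q'" by (rule Cons.IH)
  then show ?case using Cons.prems(2) e by (simp add: q awalk_functional_graph_Cons)
qed

lemma awalk_functional_graph_ex:
  assumes "f \<in> V - {x} \<rightarrow> V" and "hits f {x} x y" and "y \<in> V"
  shows "\<exists>p. pre_digraph.awalk (functional_graph V x f) y p x"
  using assms(2,3)
proof (induction rule: hits.induct)
  case stop
  then have "pre_digraph.awalk (functional_graph V x f) x [] x"
    by (simp add: pre_digraph.awalk_def pre_digraph.cas.simps functional_graph_def)
  then show ?case ..
next
  case (step y)
  then have "f y \<in> V" using assms(1) by auto
  with step obtain p where "pre_digraph.awalk (functional_graph V x f) (f y) p x" by blast
  with step have "pre_digraph.awalk (functional_graph V x f) y ((y, f y) # p) x"
    by (simp add: awalk_functional_graph_Cons) (simp add: pre_digraph.awalk_def)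
  then show ?case ..
qed

lemma functional_graph_arborescence:
  assumes f: "f \<in> V - {x} \<rightarrow>\<^sub>E V" and x: "x \<in> V" and flow: "flows_to V x f"
  shows "functional_graph V x f \<in> arborescences (complete_graph_on V) x"
proof -
  have fV: "f \<in> V - {x} \<rightarrow> V" using f by auto
  \<comment> \<open>A fixed point would make \<open>{y}\<close> a closed set that misses the
    root.\<close>
  have "y \<noteq> f y" if "y \<in> V - {x}" for y
  proof
    assume "y = f y"
    moreover have "hits f {x} x y" using flow that by (auto simp: flows_to_def)
    ultimately show False
      using hits_avoids[of f "{x}" x y "{y}"] that by auto
  qed
  then have "spanning (functional_graph V x f) (complete_graph_on V)"
    using fV by (auto simp: spanning_def subgraph_def compatible_def functional_graph_def
        complete_graph_on_def wf_digraph_def)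
  moreover have "\<exists>!p. pre_digraph.awalk (functional_graph V x f) y p x" if "y \<in> V" for y
    using awalk_functional_graph_ex[OF fV _ that] awalk_functional_graph_unique[OF fV] flow that
    by (metis flows_to_def)
  ultimately show ?thesis by (simp add: arborescences_def complete_graph_on_def)
qed

text \<open>Uniqueness of walks yields the map: an arc leaving the root would extend to a nontrivial
  closed walk there, and two arcs leaving the same vertex would extend to two different walks to the
  root.\<close>

lemma arborescence_functional_graph:
  assumes T: "T \<in> arborescences (complete_graph_on V) x" and x: "x \<in> V"
  obtains f where "f \<in> V - {x} \<rightarrow>\<^sub>E V" "flows_to V x f" "T = functional_graph V x f"
proof -
  have T_simps: "verts T = V" "tail T = fst" "head T = snd" and arcsV: "arcs T \<subseteq> V \<times> V"
    using T by (auto simp: arborescences_def spanning_def subgraph_def compatible_def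
        complete_graph_on_def)
  have awalk: "pre_digraph.awalk T u [] v \<longleftrightarrow> u \<in> V \<and> u = v"
    "pre_digraph.awalk T u (e # p) v \<longleftrightarrow> e \<in> arcs T \<and> fst e = u \<and> pre_digraph.awalk T (snd e) p v"
    for u v e p
    using arcsV by (auto simp: pre_digraph.awalk_def pre_digraph.cas.simps T_simps)
  have ex1: "\<exists>!p. pre_digraph.awalk T y p x" if "y \<in> V" for y
    using T that by (simp add: arborescences_def complete_graph_on_def)
  have ex_awalk: "\<exists>p. pre_digraph.awalk T y p x" if "y \<in> V" for y
    using ex1[OF that] by (rule ex1_implies_ex)
  have awalk_unique: "p = q" if "pre_digraph.awalk T y p x" "pre_digraph.awalk T y q x" for y p q
    using ex1[of y] that by (auto simp: pre_digraph.awalk_def T_simps)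
  have root: "(x, a) \<notin> arcs T" for a
  proof
    assume a: "(x, a) \<in> arcs T"
    then obtain p where "pre_digraph.awalk T a p x" using arcsV ex_awalk[of a] by auto
    then have "pre_digraph.awalk T x ((x, a) # p) x" using a by (simp add: awalk)
    moreover have "pre_digraph.awalk T x [] x" using x by (simp add: awalk)
    ultimately show False using awalk_unique by blast
  qed
  have out: "\<exists>!a. (y, a) \<in> arcs T" if y: "y \<in> V - {x}" for y
  proof -
    obtain p where p: "pre_digraph.awalk T y p x" using ex_awalk[of y] y by auto
    show ?thesis
    proof (cases p)
      case Nil
      then show ?thesis using p y by (simp add: awalk)
    next
      case (Cons e q)
      then have e: "(y, snd e) \<in> arcs T" using p by (auto simp: awalk)
      have "a = b" if a: "(y, a) \<in> arcs T" and b: "(y, b) \<in> arcs T" for a b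
      proof -
        have "a \<in> V" "b \<in> V" using a b arcsV by auto
        then obtain p q where "pre_digraph.awalk T a p x" "pre_digraph.awalk T b q x"
          using ex_awalk[of a] ex_awalk[of b] by auto
        then have "pre_digraph.awalk T y ((y, a) # p) x" "pre_digraph.awalk T y ((y, b) # q) x"
          using a b by (simp_all add: awalk)
        then have "(y, a) # p = (y, b) # q" by (rule awalk_unique)
        then show ?thesis by simp
      qed
      with e show ?thesis by blast
    qed
  qed
  define f where "f = restrict (\<lambda>y. THE a. (y, a) \<in> arcs T) (V - {x})"
  have f: "(y, f y) \<in> arcs T" if "y \<in> V - {x}" for y
    using theI'[OF out[OF that]] that by (simp add: f_def)
  have arcs: "arcs T = (\<lambda>y. (y, f y)) ` (V - {x})"
  proof
    show "(\<lambda>y. (y, f y)) ` (V - {x}) \<subseteq> arcs T" using f by auto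
    show "arcs T \<subseteq> (\<lambda>y. (y, f y)) ` (V - {x})"
    proof
      fix e assume e: "e \<in> arcs T"
      obtain y a where ya: "e = (y, a)" by (cases e)
      then have y: "y \<in> V - {x}" using e arcsV root by auto
      then have "a = f y" using out f e ya by blast
      then show "e \<in> (\<lambda>y. (y, f y)) ` (V - {x})" using y ya by blast
    qed
  qed
  have "hits f {x} x y" if "pre_digraph.awalk T y p x" for p y
    using that
  proof (induction p arbitrary: y)
    case Nil
    then show ?case by (simp add: awalk hits.stop)
  next
    case (Cons e p)
    then have "e = (y, f y)" "y \<noteq> x" "hits f {x} x (snd e)"
      by (auto simp: awalk arcs)
    then show ?case by (auto intro: hits.step)
  qed
  then have "flows_to V x f" using ex_awalk unfolding flows_to_def by blast
  moreover have "f \<in> V - {x} \<rightarrow>\<^sub>E V"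
    using f arcsV by (auto simp: f_def)
  moreover have "T = functional_graph V x f"
    using T_simps arcs by (simp add: functional_graph_def)
  ultimately show ?thesis using that by blast
qed

text \<open>Applied to both graphs, this turns the theorem into an identity between sums over maps.
  Maps with a fixed point outside the root are included but fail \<open>flows_to\<close>, so
  diagonal values of \<open>r\<close> contribute nothing and each value can range over a full
  product set.\<close>

lemma collection_weight_arborescences:
  assumes "finite V" and "x \<in> V"
  shows "collection_weight r (arborescences (complete_graph_on V) x) =
    (\<Sum>f\<in>V - {x} \<rightarrow>\<^sub>E V. (\<Prod>y\<in>V - {x}. r (y, f y)) * of_bool (flows_to V x f))"
proof -
  let ?F = "{f \<in> V - {x} \<rightarrow>\<^sub>E V. flows_to V x f}"
  have arb: "arborescences (complete_graph_on V) x = functional_graph V x ` ?F"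
    using functional_graph_arborescence[OF _ assms(2)] arborescence_functional_graph[OF _ assms(2)]
    by (auto, blast)
  have inj: "inj_on (functional_graph V x) ?F"
  proof (rule inj_onI)
    fix f g assume f: "f \<in> ?F" and g: "g \<in> ?F"
      and "functional_graph V x f = functional_graph V x g"
    then have "(\<lambda>y. (y, f y)) ` (V - {x}) = (\<lambda>y. (y, g y)) ` (V - {x})"
      by (simp add: functional_graph_def)
    then have "f y = g y" if "y \<in> V - {x}" for y using that by blast
    with f g show "f = g" by (intro PiE_ext[of f "V - {x}" "\<lambda>_. V" g]) auto
  qed
  have weight: "subgraph_weight r (functional_graph V x f) = (\<Prod>y\<in>V - {x}. r (y, f y))" for f
    by (simp add: subgraph_weight_def functional_graph_def prod.reindex inj_on_def)
  have fin: "finite (V - {x} \<rightarrow>\<^sub>E V)" using assms(1) by (intro finite_PiE) auto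
  have "collection_weight r (arborescences (complete_graph_on V) x) =
      (\<Sum>f\<in>?F. \<Prod>y\<in>V - {x}. r (y, f y))"
    by (simp add: collection_weight_def arb sum.reindex[OF inj] weight)
  also have "\<dots> = (\<Sum>f\<in>V - {x} \<rightarrow>\<^sub>E V. (\<Prod>y\<in>V - {x}. r (y, f y)) * of_bool (flows_to V x f))"
    using fin by (intro sum.mono_neutral_cong_left) auto
  finally show ?thesis .
qed

section \<open>Redirecting the values of a map\<close>

lemma sum_PiE_insert:
  fixes h :: "('a \<Rightarrow> 'b) \<Rightarrow> 'c::comm_monoid_add"
  assumes "u \<notin> U"
  shows "(\<Sum>f\<in>insert u U \<rightarrow>\<^sub>E B. h f) = (\<Sum>f\<in>U \<rightarrow>\<^sub>E B. \<Sum>z\<in>B. h (f(u := z)))"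
proof -
  have "(\<Sum>f\<in>insert u U \<rightarrow>\<^sub>E B. h f) =
      (\<Sum>(z, f)\<in>B \<times> (U \<rightarrow>\<^sub>E B). h (f(u := z)))"
    using inj_combinator[OF assms, of "\<lambda>_. B"]
    by (simp add: PiE_insert_eq sum.reindex case_prod_unfold)
  also have "\<dots> = (\<Sum>z\<in>B. \<Sum>f\<in>U \<rightarrow>\<^sub>E B. h (f(u := z)))"
    by (simp add: sum.cartesian_product)
  finally show ?thesis by (simp add: sum.swap[of _ B])
qed

text \<open>\<open>C t y\<close> says that \<open>t\<close> is the first of \<open>x\<close>,
  \<open>b\<close>, \<open>s\<close> met from \<open>y\<close>, which is independent of the values
  at \<open>b\<close> and \<open>s\<close>. Contracting the three resulting trees leaves one arc out
  of \<open>b\<close> and one out of \<open>s\<close>; the final disjunction lists the acyclic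
  choices. Allowing \<open>z' = s\<close> covers the redirected map as well.\<close>

lemma flows_to_two_updates:
  fixes k :: "'a \<Rightarrow> 'a" and x b s :: 'a
  defines "C \<equiv> hits k {x, b, s}"
  assumes "b \<in> V" "s \<in> V" "b \<noteq> s" "b \<noteq> x" "s \<noteq> x" "z \<in> V" "z' \<in> V"
  shows "flows_to V x (k(b := z', s := z)) \<longleftrightarrow>
    (\<forall>y\<in>V. \<exists>t\<in>{x, b, s}. C t y) \<and>
    (C x z' \<and> (C x z \<or> C b z) \<or> C s z' \<and> C x z)" (is "?L \<longleftrightarrow> ?A \<and> ?R")
proof -
  define f where "f = k(b := z', s := z)"
  have f: "f b = z'" "f s = z" "\<And>u. u \<notin> {b, s} \<Longrightarrow> f u = k u"
    using \<open>b \<noteq> s\<close> by (auto simp: f_def)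
  have C_stop: "C t t" if "t \<in> {x, b, s}" for t
    using that by (auto simp: C_def hits_stop_iff)
  have C_step: "C t (f y) = C t y" if "y \<notin> {x, b, s}" for t y
    using that f(3) by (auto simp: C_def hits_step_iff)
  have C_unique: "t = t'" if "C t y" "C t' y" for t t' y
    using that by (auto simp: C_def intro: hits_unique)
  have into_C: "\<exists>t\<in>{x, b, s}. C t y" if "hits f {x} x y" for y
    using that
  proof (induction rule: hits.induct)
    case (step y)
    then show ?case using C_stop[of y] C_step[of y] by blast
  qed (use C_stop in auto)
  have from_C: "hits f {x} x y" if "C t y" "hits f {x} x t" for t y
    using that(1) unfolding C_def
  proof (induction rule: hits.induct)
    case (step y)
    then show ?case using f(3)[of y] by (auto intro: hits.step)
  qed (use that in auto)
  have x: "hits f {x} x x" by (auto intro: hits.stop)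
  have b: "hits f {x} x b \<longleftrightarrow> hits f {x} x z'" and s: "hits f {x} x s \<longleftrightarrow> hits f {x} x z"
    using f assms by (auto simp: hits_step_iff)
  \<comment> \<open>If the roots in \<open>N\<close> are sent back into the trees of
    \<open>N\<close>, the union of these trees is closed under \<open>f\<close> and misses
    \<open>x\<close>.\<close>
  have avoid: "\<not> hits f {x} x y"
    if y: "C t y" "t \<in> N" and N: "N \<subseteq> {b, s}"
      and closed: "\<And>t. t \<in> N \<Longrightarrow> \<exists>t'\<in>N. C t' (f t)" for t y N
  proof
    assume "hits f {x} x y"
    then have "y \<notin> {u. \<exists>t\<in>N. C t u}"
    proof (rule hits_avoids)
      show "x \<notin> {u. \<exists>t\<in>N. C t u}"
        using C_unique[OF C_stop[of x]] N assms by auto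
      fix u assume "u \<in> {u. \<exists>t\<in>N. C t u}"
      then obtain t where t: "t \<in> N" "C t u" by auto
      show "f u \<in> {u. \<exists>t\<in>N. C t u}"
      proof (cases "u \<in> {x, b, s}")
        case True
        then have "u = t" using C_unique C_stop t by blast
        then show ?thesis using closed t by auto
      next
        case False
        then show ?thesis using C_step t by blast
      qed
    qed
    then show False using y by auto
  qed
  show ?thesis unfolding f_def[symmetric]
  proof
    assume L: "flows_to V x f"
    then have A: ?A and hb: "hits f {x} x b" and hs: "hits f {x} x s"
      using into_C assms by (auto simp: flows_to_def)
    \<comment> \<open>After contraction the possible cycles are a loop at \<open>b\<close>, a loop
      at \<open>s\<close> and the two-cycle between them.\<close>
    have "\<not> C b z'" using avoid[of b b "{b}"] hb C_stop f by auto
    moreover have "\<not> C s z" using avoid[of s s "{s}"] hs C_stop f by auto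
    moreover have "\<not> (C s z' \<and> C b z)" using avoid[of b b "{b, s}"] hb C_stop f by auto
    ultimately have ?R using A \<open>z \<in> V\<close> \<open>z' \<in> V\<close> by blast
    with A show "?A \<and> ?R" ..
  next
    assume AR: "?A \<and> ?R"
    then have "hits f {x} x b \<and> hits f {x} x s"
      using b s from_C x by blast
    then show "flows_to V x f"
      using AR from_C x unfolding flows_to_def by blast
  qed
qed

text \<open>
  Contracting the trees that flow into \<open>x\<close>, \<open>b\<close> and \<open>s\<close>, the left side has the configurations
  \<open>b \<rightarrow> x, s \<rightarrow> x\<close> and \<open>b \<rightarrow> x, s \<rightarrow> b\<close> and \<open>b \<rightarrow> s, s \<rightarrow> x\<close>, and the right side fixes \<open>s \<rightarrow> x\<close>
  while the additional factor \<open>w z'\<close> ranges over all three trees. Swapping \<open>z\<close> and \<open>z'\<close> matches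
  the second configuration.
\<close>
lemma sum_flows_to_redirect:
  fixes w :: "'a \<Rightarrow> real"
  assumes "finite W" "s \<notin> W" "x \<in> W" "b \<in> W" "b \<noteq> x"
  defines "\<Phi> \<equiv> \<lambda>k. \<Sum>z\<in>W. w z * of_bool (flows_to (insert s W) x (k(s := z)))"
  shows "(\<Sum>z'\<in>W. w z' * \<Phi> (k(b := z'))) = (\<Sum>z'\<in>W. w z') * \<Phi> (k(b := s))"
proof -
  define C where "C = hits k {x, b, s}"
  define A where "A \<longleftrightarrow> (\<forall>y\<in>insert s W. \<exists>t\<in>{x, b, s}. C t y)"
  define c :: "'a \<Rightarrow> 'a \<Rightarrow> real" where "c t y = of_bool (C t y)" for t y
  have neq: "b \<noteq> s" "s \<noteq> x" using assms by auto
  have upd: "flows_to (insert s W) x (k(b := z', s := z)) \<longleftrightarrow>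
      A \<and> (C x z' \<and> (C x z \<or> C b z) \<or> C s z' \<and> C x z)"
    if "z \<in> W" "z' \<in> insert s W" for z z'
    using flows_to_two_updates[of b "insert s W" s x z z' k] that assms neq
    by (auto simp: C_def A_def)
  have unique: "C t y \<Longrightarrow> C t' y \<Longrightarrow> t = t'" for t t' y
    by (auto simp: C_def intro: hits_unique)
  \<comment> \<open>Redirecting \<open>b\<close> to \<open>s\<close> is the case
    \<open>z' = s\<close>, where only the alternative \<open>C s z' \<and> C x z\<close> can
    hold.\<close>
  have Css: "C s s" "\<not> C x s" using neq by (auto simp: C_def hits_stop_iff)
  \<comment> \<open>The alternatives are mutually exclusive by \<open>unique\<close>, so the
    disjunction becomes a sum of indicators.\<close>
  have lhs: "of_bool (flows_to (insert s W) x (k(b := z', s := z))) =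
      of_bool A * (c x z' * c x z + c x z' * c b z + c s z' * c x z)"
    if "z \<in> W" "z' \<in> W" for z z'
    using upd[of z z'] that unique[of x z b] unique[of x z' s] assms neq
    by (auto simp: c_def)
  have rhs: "of_bool (flows_to (insert s W) x (k(b := s, s := z))) = of_bool A * c x z"
    if "z \<in> W" for z
    using upd[of z s] that Css by (auto simp: c_def)
  \<comment> \<open>Under \<open>A\<close> the trees partition the vertices, which lets
    \<open>z'\<close> be summed out freely.\<close>
  have total: "of_bool A * (c x y + c b y + c s y) = of_bool A" if "y \<in> W" for y
    using that unique[of x y b] unique[of x y s] unique[of b y s] assms neq
    by (auto simp: c_def A_def)
  have swap: "(\<Sum>z'\<in>W. \<Sum>z\<in>W. w z' * w z * (c x z' * c b z)) =
      (\<Sum>z'\<in>W. \<Sum>z\<in>W. w z' * w z * (c b z' * c x z))"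
    by (subst sum.swap) (simp add: mult_ac)
  have "(\<Sum>z'\<in>W. w z' * \<Phi> (k(b := z'))) =
      of_bool A * (\<Sum>z'\<in>W. \<Sum>z\<in>W. w z' * w z * (c x z' * c x z + c x z' * c b z + c s z' * c x z))"
    by (simp add: \<Phi>_def lhs sum_distrib_left mult_ac cong: sum.cong)
  also have "\<dots> =
      of_bool A * (\<Sum>z'\<in>W. \<Sum>z\<in>W. w z' * w z * (c x z' * c x z + c b z' * c x z + c s z' * c x z))"
    using swap by (simp add: distrib_left sum.distrib)
  also have "\<dots> = (\<Sum>z'\<in>W. \<Sum>z\<in>W. w z' * w z * c x z * (of_bool A * (c x z' + c b z' + c s z')))"
    by (simp add: sum_distrib_left algebra_simps)
  also have "\<dots> = (\<Sum>z'\<in>W. \<Sum>z\<in>W. w z' * w z * c x z * of_bool A)"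
    by (simp add: total cong: sum.cong)
  also have "\<dots> = (\<Sum>z'\<in>W. w z') * \<Phi> (k(b := s))"
    by (simp add: \<Phi>_def rhs sum_product mult_ac cong: sum.cong)
  finally show ?thesis .
qed

text \<open>Induction on \<open>U\<close>, with \<Phi> arbitrary: summing out the value of one
  vertex gives a functional \<Psi> on the remaining maps that again satisfies the redirection
  hypothesis.\<close>

lemma sum_PiE_redirect:
  fixes \<Phi> :: "('a \<Rightarrow> 'a) \<Rightarrow> real" and p w :: "_ \<Rightarrow> real"
  assumes "finite U" "finite W" "s \<notin> W" and S: "(\<Sum>z\<in>W. w z) \<noteq> 0"
    and "\<And>b k. b \<in> U \<Longrightarrow> (\<Sum>z\<in>W. w z * \<Phi> (k(b := z))) = (\<Sum>z\<in>W. w z) * \<Phi> (k(b := s))"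
  shows "(\<Sum>g\<in>U \<rightarrow>\<^sub>E W. (\<Prod>u\<in>U. p (u, g u) + p (u, s) * w (g u) / (\<Sum>z\<in>W. w z)) * \<Phi> g) =
         (\<Sum>f\<in>U \<rightarrow>\<^sub>E insert s W. (\<Prod>u\<in>U. p (u, f u)) * \<Phi> f)"
  using assms(1,5)
proof (induction U arbitrary: \<Phi> rule: finite_induct)
  case empty
  then show ?case by simp
next
  case (insert u U)
  define S where "S = (\<Sum>z\<in>W. w z)"
  define q where "q v z = p (v, z) + p (v, s) * w z / S" for v z
  define \<Psi> where "\<Psi> g = (\<Sum>z\<in>W. q u z * \<Phi> (g(u := z)))" for g
  have S0: "S \<noteq> 0" using S by (simp add: S_def)
  have upd: "(\<Prod>v\<in>insert u U. h v ((g(u := z)) v)) = h u z * (\<Prod>v\<in>U. h v (g v))"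
    for h :: "'a \<Rightarrow> 'a \<Rightarrow> real" and g z
    using insert.hyps by (auto intro!: prod.cong)
  \<comment> \<open>The second summand of \<open>q\<close> averages over \<open>W\<close>;
    redirection turns this average into the single missing value \<open>s\<close>, with weight
    \<open>p (u, s)\<close>.\<close>
  have \<Psi>: "\<Psi> g = (\<Sum>z\<in>insert s W. p (u, z) * \<Phi> (g(u := z)))" for g
  proof -
    have "\<Psi> g = (\<Sum>z\<in>W. p (u, z) * \<Phi> (g(u := z))) +
        p (u, s) / S * (\<Sum>z\<in>W. w z * \<Phi> (g(u := z)))"
      by (simp add: \<Psi>_def q_def distrib_right distrib_left sum.distrib sum_distrib_left mult_ac)
    also have "(\<Sum>z\<in>W. w z * \<Phi> (g(u := z))) = S * \<Phi> (g(u := s))"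
      unfolding S_def by (rule insert.prems) simp
    finally show ?thesis using S0 assms(2,3) by (simp del: fun_upd_apply)
  qed
  \<comment> \<open>Updates at \<open>b\<close> and \<open>u\<close> commute, so \<Psi> inherits the
    hypothesis from \<Phi> term by term.\<close>
  have step: "(\<Sum>z\<in>W. w z * \<Psi> (k(b := z))) = S * \<Psi> (k(b := s))" if "b \<in> U" for b k
  proof -
    have "b \<noteq> u" using that insert.hyps by auto
    then have "(\<Sum>z\<in>W. w z * \<Psi> (k(b := z))) =
        (\<Sum>v\<in>W. q u v * (\<Sum>z\<in>W. w z * \<Phi> ((k(u := v))(b := z))))"
      by (simp add: \<Psi>_def sum_distrib_left fun_upd_twist mult_ac) (subst sum.swap, simp)
    also have "\<dots> = (\<Sum>v\<in>W. q u v * (S * \<Phi> ((k(u := v))(b := s))))"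
      unfolding S_def using that by (intro sum.cong refl arg_cong2[of _ _ _ _ "(*)"] insert.prems) auto
    also have "\<dots> = S * \<Psi> (k(b := s))"
      using \<open>b \<noteq> u\<close> by (simp add: \<Psi>_def sum_distrib_left fun_upd_twist mult_ac)
    finally show ?thesis .
  qed
  have "(\<Sum>g\<in>insert u U \<rightarrow>\<^sub>E W. (\<Prod>v\<in>insert u U. q v (g v)) * \<Phi> g) =
      (\<Sum>g\<in>U \<rightarrow>\<^sub>E W. (\<Prod>v\<in>U. q v (g v)) * \<Psi> g)"
    unfolding sum_PiE_insert[OF insert.hyps(2)] upd
    by (simp add: \<Psi>_def sum_distrib_left mult_ac)
  also have "\<dots> = (\<Sum>f\<in>U \<rightarrow>\<^sub>E insert s W. (\<Prod>v\<in>U. p (v, f v)) * \<Psi> f)"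
    unfolding q_def S_def by (intro insert.IH step[unfolded S_def])
  also have "\<dots> = (\<Sum>f\<in>insert u U \<rightarrow>\<^sub>E insert s W. (\<Prod>v\<in>insert u U. p (v, f v)) * \<Phi> f)"
    unfolding sum_PiE_insert[OF insert.hyps(2)] upd[of "\<lambda>v z. p (v, z)"] \<Psi>
    by (simp only: sum_distrib_left mult_ac)
  finally show ?case by (simp add: q_def S_def)
qed

section \<open>Return to the reduced graph, and the conclusion\<close>

lemma flows_to_insert_iff:
  assumes g: "g \<in> W - {x} \<rightarrow> W" and "s \<notin> W" "x \<in> W" "z \<in> W"
  shows "flows_to (insert s W) x (g(s := z)) \<longleftrightarrow> flows_to W x g"
proof -
  \<comment> \<open>Starting in \<open>W\<close>, the iteration stays in \<open>W\<close> until it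
    stops, so it never consults the value at \<open>s\<close>.\<close>
  have eq: "hits (g(s := z)) {x} x y \<longleftrightarrow> hits g {x} x y" if "y \<in> W" for y
  proof
    have "(g(s := z)) u = g u \<and> g u \<in> W" if "u \<in> W - {x}" for u
      using g \<open>s \<notin> W\<close> that by auto
    then show "hits (g(s := z)) {x} x y \<Longrightarrow> hits g {x} x y"
      "hits g {x} x y \<Longrightarrow> hits (g(s := z)) {x} x y"
      using that by (auto elim!: hits_cong_closed simp del: fun_upd_apply)
  qed
  have "hits (g(s := z)) {x} x s \<longleftrightarrow> hits g {x} x z"
    using assms eq by (subst hits_step_iff) auto
  with eq assms show ?thesis by (auto simp: flows_to_def)
qed

lemma not_flows_to_loop:
  assumes "s \<in> V" "s \<noteq> x" shows "\<not> flows_to V x (f(s := s))"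
  using hits_avoids[of "f(s := s)" "{x}" x s "{s}"] assms by (auto simp: flows_to_def)

theorem proposition4p2:
  fixes W :: "'a set" and s x\<^sub>1 :: 'a and n :: nat and r :: "'a \<times> 'a \<Rightarrow> real"
  assumes "finite W" and "card W = n" and "s \<notin> W"
    and "\<forall>e \<in> arcs (complete_graph_on (insert s W)). r e \<ge> 0"
    and "x\<^sub>1 \<in> W"
  shows "collection_weight r (arborescences (complete_graph_on (insert s W)) x\<^sub>1) =
         out_weight W r s *
         collection_weight (star_delta_weight W r s) (arborescences (complete_graph_on W) x\<^sub>1)"
proof -
  define S where "S = out_weight W r s"
  define U where "U = W - {x\<^sub>1}"
  define \<Phi> where
    "\<Phi> k = (\<Sum>z\<in>W. r (s, z) * of_bool (flows_to (insert s W) x\<^sub>1 (k(s := z))))" for k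
  have S: "(\<Sum>z\<in>W. r (s, z)) = S" by (simp add: S_def out_weight_def)
  have V: "insert s W - {x\<^sub>1} = insert s U" and sU: "s \<notin> U" and sx: "s \<noteq> x\<^sub>1" and finU: "finite U"
    using assms by (auto simp: U_def)
  have prod: "(\<Prod>y\<in>insert s U. r (y, (f(s := z)) y)) = r (s, z) * (\<Prod>y\<in>U. r (y, f y))" for f z
    using sU finU by (auto intro!: prod.cong)
  have "collection_weight r (arborescences (complete_graph_on (insert s W)) x\<^sub>1) =
      (\<Sum>f\<in>insert s U \<rightarrow>\<^sub>E insert s W. (\<Prod>y\<in>insert s U. r (y, f y)) *
        of_bool (flows_to (insert s W) x\<^sub>1 f))"
    using assms by (simp add: collection_weight_arborescences V)
  \<comment> \<open>The value of \<open>s\<close> is summed out; the value \<open>s\<close> itself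
    drops because a loop at \<open>s\<close> never reaches the root.\<close>
  also have "\<dots> = (\<Sum>f\<in>U \<rightarrow>\<^sub>E insert s W. (\<Prod>y\<in>U. r (y, f y)) * \<Phi> f)"
    unfolding sum_PiE_insert[OF sU] prod using assms sx not_flows_to_loop[of s "insert s W" x\<^sub>1]
    by (simp add: \<Phi>_def sum_distrib_left mult_ac del: sum_mult_of_bool_eq)
  finally have lhs: "collection_weight r (arborescences (complete_graph_on (insert s W)) x\<^sub>1) =
      (\<Sum>f\<in>U \<rightarrow>\<^sub>E insert s W. (\<Prod>y\<in>U. r (y, f y)) * \<Phi> f)" .
  show ?thesis
  \<comment> \<open>If \<open>S = 0\<close>, nonnegativity makes every \<open>r (s, z)\<close>
    vanish, hence also \<Phi>, and both sides are zero. Otherwise division by \<open>S\<close> is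
    legitimate.\<close>
  proof (cases "S = 0")
    case True
    have "r (s, z) \<ge> 0" if "z \<in> W" for z
      using assms that by (auto simp: complete_graph_on_def)
    then have "r (s, z) = 0" if "z \<in> W" for z
      using True S assms(1) that sum_nonneg_eq_0_iff[of W "\<lambda>z. r (s, z)"] by auto
    then have "\<Phi> k = 0" for k by (simp add: \<Phi>_def)
    then show ?thesis using True lhs by (simp add: S_def)
  next
    case False
    have \<Phi>_W: "\<Phi> g = S * of_bool (flows_to W x\<^sub>1 g)" if "g \<in> U \<rightarrow>\<^sub>E W" for g
    proof -
      have "g \<in> W - {x\<^sub>1} \<rightarrow> W" using that by (auto simp: U_def)
      from flows_to_insert_iff[OF this assms(3,5)] show ?thesis
        by (simp add: \<Phi>_def flip: S sum_distrib_right cong: sum.cong)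
    qed
    have "(\<Sum>z'\<in>W. r (s, z') * \<Phi> (k(b := z'))) = S * \<Phi> (k(b := s))" if "b \<in> U" for b k
      using sum_flows_to_redirect[of W s x\<^sub>1 b "\<lambda>z. r (s, z)" k] assms that
      by (simp add: \<Phi>_def U_def S)
    then have "(\<Sum>f\<in>U \<rightarrow>\<^sub>E insert s W. (\<Prod>y\<in>U. r (y, f y)) * \<Phi> f) =
        (\<Sum>g\<in>U \<rightarrow>\<^sub>E W. (\<Prod>u\<in>U. r (u, g u) + r (u, s) * r (s, g u) / S) * \<Phi> g)"
      using sum_PiE_redirect[of U W s "\<lambda>z. r (s, z)" \<Phi> r] assms finU False by (simp add: S)
    also have "\<dots> = (\<Sum>g\<in>U \<rightarrow>\<^sub>E W. S * ((\<Prod>u\<in>U. star_delta_weight W r s (u, g u)) *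
        of_bool (flows_to W x\<^sub>1 g)))"
      using False by (intro sum.cong) (simp_all add: \<Phi>_W star_delta_weight_def star_weight_def S_def)
    also have "\<dots> = S * collection_weight (star_delta_weight W r s)
        (arborescences (complete_graph_on W) x\<^sub>1)"
      using assms by (simp add: collection_weight_arborescences U_def sum_distrib_left)
    finally show ?thesis using lhs by (simp add: S_def)
  qed
qed

end
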